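(* Let $n,m\ge 1$ and let $\mathcal{A}:\mathbb{H}^{n\times n}\to\mathbb{R}^m$ be an arbitrary $\mathbb{R}$-linear operator. Let $\hat{x}\in\mathbb{C}^n$, $\hat{X}=\hat{x}\hat{x}^*$, and $b=\mathcal{A}(\hat{X})$ (no measurement noise), with $b\neq 0$. Then for every $\lambda>0$ the problems $$\min_{X\in\mathbb{C}^{n\times n}}\ \|\mathcal{A}(X)-b\|_2^2\quad\text{s.t.}\quad X\succeq 0,\ \operatorname{rank}(X)=1$$ and $$\min_{X\in\mathbb{C}^{n\times n}}\ \tfrac12\|\mathcal{A}(X)-b\|_2^2+\lambda\left(\operatorname{Tr}(X)-\|X\|_F\right)\quad\text{s.t.}\quad X\succeq 0$$ are equivalent in the sense that they have the same set of solutions (global minimizers).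
   Context: $\mathbb{H}^{n\times n}$ is the real vector space of $n\times n$ complex Hermitian matrices. $\|X\|_F=\sqrt{\operatorname{Tr}(X^*X)}$ is the Frobenius norm. $X\succeq0$ means $X$ is Hermitian positive semidefinite. *)

theory Defs
  imports "HOL-Analysis.Analysis"
begin

definition adjoint_matrix :: "complex^'n^'m \<Rightarrow> complex^'m^'n" where
  "adjoint_matrix X = (\<chi> i j. cnj (X $ j $ i))"

definition hermitian :: "(complex^'n^'n) set" where
  "hermitian = {X. adjoint_matrix X = X}"

lemma subspace_hermitian: "subspace hermitian"
  by (auto simp: subspace_def hermitian_def adjoint_matrix_def vec_eq_iff)

(* For Hermitian X the form v^* X v is real, so taking its real part loses nothing. *)
definition psd :: "complex^'n^'n \<Rightarrow> bool" where
  "psd X \<longleftrightarrow> X \<in> hermitian \<and>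
     (\<forall>v::complex^'n. 0 \<le> Re (\<Sum>i\<in>UNIV. cnj (v $ i) * (X *v v) $ i))"

definition outer_self :: "complex^'n \<Rightarrow> complex^'n^'n" where
  "outer_self x = (\<chi> i j. x $ i * cnj (x $ j))"

(* Tr (X^* X) is always a nonnegative real. *)
definition frobenius_norm :: "complex^'n^'n \<Rightarrow> real" where
  "frobenius_norm X = sqrt (Re (trace (adjoint_matrix X ** X)))"

(* Real-linearity of a map whose domain is the real subspace S; the values of the total
   HOL function f outside S are unconstrained. *)
definition real_linear_on :: "'a::real_vector set \<Rightarrow> ('a \<Rightarrow> 'b::real_vector) \<Rightarrow> bool" where
  "real_linear_on S f \<longleftrightarrow>
     (\<forall>x\<in>S. \<forall>y\<in>S. f (x + y) = f x + f y) \<and>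
     (\<forall>c. \<forall>x\<in>S. f (c *\<^sub>R x) = c *\<^sub>R f x)"

end

theory Submission
  imports Defs
begin

text \<open>
  Both problems have optimal value \<open>0\<close>, attained at \<^term>\<open>outer_self xhat\<close>, and the minimizers of
  either are exactly its feasible points of value \<open>0\<close>. So the claim reduces to one fact:
  for a positive semidefinite \<open>X\<close>, the penalty \<open>Tr X - \<parallel>X\<parallel>\<^sub>F\<close> is nonnegative, and if \<open>X \<noteq> 0\<close>
  it vanishes if and only if \<open>X\<close> has rank one. The case \<open>X = 0\<close>, where the penalty also
  vanishes, is excluded by \<open>b \<noteq> 0\<close>, since it leaves the residual \<open>b\<close>.

  The fact about the penalty needs no eigenvalues. The Cauchy--Schwarz inequality for the
  semidefinite form \<open>u\<^sup>* X v\<close>, applied to unit vectors, bounds each entry by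
  \<open>\<bar>X\<^sub>i\<^sub>j\<bar>\<^sup>2 \<le> X\<^sub>i\<^sub>i X\<^sub>j\<^sub>j\<close>, and summing over all entries gives \<open>\<parallel>X\<parallel>\<^sub>F\<^sup>2 \<le> (Tr X)\<^sup>2\<close>. Equality forces equality
  in every entry (\<open>frobenius_norm_eq_trace_iff\<close>). If \<open>X\<^sub>k\<^sub>k \<noteq> 0\<close>, equality at the entries
  \<open>(k, j)\<close> produces a vector on which the form vanishes, hence by Cauchy--Schwarz a vector in the kernel of \<open>X\<close>,
  which says that column \<open>j\<close> is a multiple of column \<open>k\<close>; thus \<open>X\<close> has rank one. Conversely, for a Hermitian matrix
  \<open>X\<^sub>i\<^sub>j = c\<^sub>i r\<^sub>j\<close> one has \<open>\<bar>X\<^sub>i\<^sub>j\<bar>\<^sup>2 = X\<^sub>i\<^sub>j X\<^sub>j\<^sub>i = X\<^sub>i\<^sub>i X\<^sub>j\<^sub>j\<close>.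
\<close>

section \<open>Matrices of rank one\<close>

text \<open>Rank one means that the rows span a line: take \<open>r\<close> to be a basis vector of this line.\<close>

lemma rank_eq_1_iff:
  fixes X :: "'a::field^'n^'m"
  shows "rank X = 1 \<longleftrightarrow> X \<noteq> 0 \<and> (\<exists>c r. \<forall>i j. X $ i $ j = c i * r j)"
proof
  assume rank: "rank X = 1"
  have "X \<noteq> 0"
  proof
    assume "X = 0"
    then have "rows X \<subseteq> {0}"
      by (auto simp: rows_def row_def vec_eq_iff)
    then have "vec.dim (rows X) = 0"
      by simp
    with rank show False
      by (simp add: row_rank_def_gen)
  qed
  obtain B where B: "rows X \<subseteq> vec.span B" "card B = vec.dim (rows X)"
    by (rule vec.basis_exists[of "rows X"])
  with rank have "card B = 1"
    by (simp add: row_rank_def_gen)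
  then obtain r where r: "B = {r}"
    by (auto simp: card_1_singleton_iff)
  have "\<exists>k. row i X = k *s r" for i
    using B(1) by (auto simp: r vec.span_singleton rows_def)
  then obtain c where c: "\<And>i. row i X = c i *s r"
    by metis
  have "X $ i $ j = c i * r $ j" for i j
    using arg_cong[OF c[of i], of "\<lambda>v. v $ j"] by (simp add: row_def)
  with \<open>X \<noteq> 0\<close> show "X \<noteq> 0 \<and> (\<exists>c r. \<forall>i j. X $ i $ j = c i * r j)"
    by blast
next
  assume R: "X \<noteq> 0 \<and> (\<exists>c r. \<forall>i j. X $ i $ j = c i * r j)"
  then obtain c r where cr: "\<And>i j. X $ i $ j = c i * r j"
    by blast
  have "row i X = c i *s (\<chi> j. r j)" for i
    by (simp add: row_def vec_eq_iff cr)
  then have "rows X \<subseteq> vec.span {\<chi> j. r j}"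
    by (auto simp: rows_def vec.span_singleton)
  from vec.dim_le_card[OF this] have "rank X \<le> 1"
    by (simp add: row_rank_def_gen)
  moreover have "rank X \<noteq> 0"
  proof
    assume "rank X = 0"
    then have "rows X \<subseteq> {0}"
      by (simp add: row_rank_def_gen)
    then have "row i X = 0" for i
      by (auto simp: rows_def)
    then have "X = 0"
      by (simp add: row_def vec_eq_iff)
    with R show False by simp
  qed
  ultimately show "rank X = 1" by simp
qed

section \<open>The form of a positive semidefinite matrix\<close>

definition sesq :: "complex^'n^'n \<Rightarrow> complex^'n \<Rightarrow> complex^'n \<Rightarrow> complex" where
  "sesq X u v = (\<Sum>i\<in>UNIV. cnj (u $ i) * (X *v v) $ i)"

lemma sesq_add_left: "sesq X (u + w) v = sesq X u v + sesq X w v"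
  by (simp add: sesq_def algebra_simps sum.distrib)

lemma sesq_add_right: "sesq X u (v + w) = sesq X u v + sesq X u w"
  by (simp add: sesq_def algebra_simps sum.distrib)

lemma sesq_scale_left: "sesq X (a *s u) v = cnj a * sesq X u v"
  by (simp add: sesq_def sum_distrib_left mult.assoc)

lemma sesq_scale_right: "sesq X u (a *s v) = a * sesq X u v"
  by (simp add: sesq_def matrix_vector_mult_def sum_distrib_left mult_ac)

lemma sesq_axis: "sesq X (axis i 1) (axis j 1) = X $ i $ j"
proof -
  have col: "(X *v axis j 1) $ k = X $ k $ j" for k
    by (simp add: matrix_vector_mult_def axis_def if_distrib cong: if_cong)
  have "sesq X (axis i 1) (axis j 1) = (\<Sum>k\<in>UNIV. if k = i then X $ k $ j else 0)"
    unfolding sesq_def col by (rule sum.cong) (auto simp: axis_def)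
  then show ?thesis by simp
qed

lemma hermitian_entry: "X \<in> hermitian \<Longrightarrow> cnj (X $ i $ j) = X $ j $ i"
  by (auto simp: hermitian_def adjoint_matrix_def vec_eq_iff)

lemma sesq_cnj:
  assumes "X \<in> hermitian"
  shows "cnj (sesq X u v) = sesq X v u"
proof -
  have "cnj (sesq X u v) = (\<Sum>i\<in>UNIV. \<Sum>j\<in>UNIV. u $ i * (X $ j $ i * cnj (v $ j)))"
    by (simp add: sesq_def matrix_vector_mult_def sum_distrib_left hermitian_entry[OF assms])
  also have "\<dots> = (\<Sum>j\<in>UNIV. \<Sum>i\<in>UNIV. u $ i * (X $ j $ i * cnj (v $ j)))"
    by (rule sum.swap)
  also have "\<dots> = sesq X v u"
    by (simp add: sesq_def matrix_vector_mult_def sum_distrib_left mult_ac)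
  finally show ?thesis .
qed

lemma psd_hermitian: "psd X \<Longrightarrow> X \<in> hermitian"
  by (simp add: psd_def)

lemma psd_sesq_nonneg: "psd X \<Longrightarrow> 0 \<le> Re (sesq X v v)"
  by (simp add: psd_def sesq_def)

text \<open>
  Positivity at the vectors \<open>u - t (v\<^sup>* X u) v\<close> makes a real quadratic polynomial in \<open>t\<close>
  nonnegative, and the claim bounds its discriminant. The form may be degenerate, so
  \<open>v\<^sup>* X v = 0\<close> needs a separate choice of \<open>t\<close>.
\<close>

lemma psd_Cauchy_Schwarz:
  assumes "psd X"
  shows "(cmod (sesq X u v))\<^sup>2 \<le> Re (sesq X u u) * Re (sesq X v v)"
proof -
  define q where "q = sesq X v u"
  define w where "w = (cmod q)\<^sup>2"
  define s where "s = Re (sesq X v v)"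
  define p where "p = Re (sesq X u u)"
  note herm = psd_hermitian[OF assms]
  have uv: "sesq X u v = cnj q"
    unfolding q_def by (rule sesq_cnj[OF herm, symmetric])
  have qq: "q * cnj q = of_real w"
    unfolding w_def by (rule complex_norm_square[symmetric])
  have quad: "0 \<le> p - 2 * t * w + t\<^sup>2 * w * s" for t :: real
  proof -
    define a where "a = - (of_real t * q)"
    have "0 \<le> Re (sesq X (u + a *s v) (u + a *s v))"
      by (rule psd_sesq_nonneg[OF assms])
    also have "sesq X (u + a *s v) (u + a *s v)
        = sesq X u u + a * cnj q + cnj a * q + cnj a * a * sesq X v v"
      by (simp add: sesq_add_left sesq_add_right sesq_scale_left sesq_scale_right uv
          q_def[symmetric] algebra_simps)
    also have "\<dots> = sesq X u u - 2 * of_real t * (q * cnj q)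
        + (of_real t)\<^sup>2 * (q * cnj q) * sesq X v v"
      by (simp add: a_def algebra_simps power2_eq_square)
    also have "\<dots> = sesq X u u - of_real (2 * t * w) + of_real (t\<^sup>2 * w) * sesq X v v"
      by (simp add: qq)
    also have "Re \<dots> = p - 2 * t * w + t\<^sup>2 * w * s"
      by (simp add: p_def s_def del: of_real_mult)
    finally show ?thesis .
  qed
  have "s \<ge> 0" "p \<ge> 0" "w \<ge> 0"
    using psd_sesq_nonneg[OF assms] by (auto simp: s_def p_def w_def)
  have "w \<le> p * s"
  proof (cases "s = 0")
    case True
    have "w = 0"
    proof (rule ccontr)
      assume "w \<noteq> 0"
      \<comment> \<open>For \<open>s = 0\<close> the polynomial is affine in \<open>t\<close>, and this \<open>t\<close> gives it the value \<open>-1\<close>.\<close>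
      with quad[of "(p + 1) / (2 * w)"] True \<open>p \<ge> 0\<close> show False
        by simp
    qed
    with True show ?thesis by simp
  next
    case False
    with \<open>s \<ge> 0\<close> have "s > 0" by simp
    \<comment> \<open>The polynomial attains its minimum at \<open>t = 1 / s\<close>.\<close>
    have "p - 2 * (1 / s) * w + (1 / s)\<^sup>2 * w * s = p - w / s"
      using False by (simp add: field_simps power2_eq_square)
    then have "w / s \<le> p"
      using quad[of "1 / s"] by linarith
    with \<open>s > 0\<close> show ?thesis
      by (simp add: pos_divide_le_eq)
  qed
  then show ?thesis
    by (simp add: uv w_def p_def s_def)
qed

lemma psd_diag:
  assumes "psd X"
  shows "0 \<le> Re (X $ i $ i)" "X $ i $ i = of_real (Re (X $ i $ i))"
  using psd_sesq_nonneg[OF assms, of "axis i 1"] hermitian_entry[OF psd_hermitian[OF assms], of i i]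
  by (simp_all add: sesq_axis complex_eq_iff)

lemma psd_entry_bound:
  assumes "psd X"
  shows "(cmod (X $ i $ j))\<^sup>2 \<le> Re (X $ i $ i) * Re (X $ j $ j)"
  using psd_Cauchy_Schwarz[OF assms, of "axis i 1" "axis j 1"] by (simp add: sesq_axis)

text \<open>
  The vector \<open>v = X\<^sub>k\<^sub>k e\<^sub>j - X\<^sub>k\<^sub>j e\<^sub>k\<close> has \<open>v\<^sup>* X v = X\<^sub>k\<^sub>k (X\<^sub>k\<^sub>k X\<^sub>j\<^sub>j - \<bar>X\<^sub>k\<^sub>j\<bar>\<^sup>2) = 0\<close>, so by Cauchy--Schwarz
  every \<open>e\<^sub>i\<^sup>* X v\<close> vanishes.
\<close>

lemma psd_entry_equality_columns:
  assumes "psd X" and eq: "(cmod (X $ k $ j))\<^sup>2 = Re (X $ k $ k) * Re (X $ j $ j)"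
  shows "X $ k $ k * X $ i $ j = X $ i $ k * X $ k $ j"
proof -
  define a where "a = X $ k $ k"
  define c where "c = X $ k $ j"
  define d where "d = - c"
  define v where "v = a *s axis j 1 + d *s axis k 1"
  note herm = hermitian_entry[OF psd_hermitian[OF assms(1)]]
  have cnjs: "cnj a = a" "cnj c = X $ j $ k"
    by (simp_all add: a_def c_def herm)
  have "c * cnj c = a * X $ j $ j"
    unfolding complex_norm_square[symmetric] using eq psd_diag(2)[OF assms(1)]
    by (metis a_def c_def of_real_mult)
  moreover have "sesq X v v = a * (a * X $ j $ j) + cnj d * (a * c) + a * (d * cnj c)
      + cnj d * (d * a)"
    by (simp add: v_def sesq_add_left sesq_add_right sesq_scale_left sesq_scale_right sesq_axis
        cnjs a_def[symmetric] c_def[symmetric] algebra_simps)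
  ultimately have "sesq X v v = 0"
    by (simp add: d_def)
  with psd_Cauchy_Schwarz[OF assms(1), of "axis i 1" v] have "sesq X (axis i 1) v = 0"
    by simp
  then have "a * X $ i $ j + d * X $ i $ k = 0"
    by (simp add: v_def sesq_add_right sesq_scale_right sesq_axis)
  then show ?thesis
    by (simp add: a_def c_def d_def mult.commute)
qed

lemma psd_outer_self: "psd (outer_self x)"
proof -
  have "0 \<le> Re (\<Sum>i\<in>UNIV. cnj (v $ i) * (outer_self x *v v) $ i)" for v
  proof -
    define z where "z = (\<Sum>j\<in>UNIV. cnj (x $ j) * v $ j)"
    have "(\<Sum>i\<in>UNIV. cnj (v $ i) * (outer_self x *v v) $ i) = (\<Sum>i\<in>UNIV. cnj (v $ i) * x $ i * z)"
      by (simp add: outer_self_def matrix_vector_mult_def z_def sum_distrib_left mult_ac)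
    also have "\<dots> = cnj z * z"
      by (simp add: z_def sum_distrib_right[symmetric] mult.commute)
    finally show ?thesis by simp
  qed
  then show ?thesis
    by (auto simp: psd_def hermitian_def adjoint_matrix_def outer_self_def vec_eq_iff)
qed

section \<open>Trace and Frobenius norm\<close>

lemma frobenius_norm_eq_entries:
  "frobenius_norm X = sqrt (\<Sum>i\<in>UNIV. \<Sum>j\<in>UNIV. (cmod (X $ i $ j))\<^sup>2)"
proof -
  have "trace (adjoint_matrix X ** X) = (\<Sum>j\<in>UNIV. \<Sum>i\<in>UNIV. of_real ((cmod (X $ i $ j))\<^sup>2))"
    unfolding complex_norm_square
    by (simp add: trace_def matrix_matrix_mult_def adjoint_matrix_def mult.commute)
  also have "\<dots> = (\<Sum>i\<in>UNIV. \<Sum>j\<in>UNIV. of_real ((cmod (X $ i $ j))\<^sup>2))"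
    by (rule sum.swap)
  finally show ?thesis
    by (simp add: frobenius_norm_def)
qed

lemma trace_eq_sqrt_entries:
  assumes "psd X"
  shows "Re (trace X) = sqrt (\<Sum>i\<in>UNIV. \<Sum>j\<in>UNIV. Re (X $ i $ i) * Re (X $ j $ j))"
proof -
  have "(\<Sum>i\<in>UNIV. \<Sum>j\<in>UNIV. Re (X $ i $ i) * Re (X $ j $ j)) = (Re (trace X))\<^sup>2"
    by (simp add: trace_def power2_eq_square sum_product)
  moreover have "0 \<le> Re (trace X)"
    using psd_diag(1)[OF assms] by (simp add: trace_def sum_nonneg)
  ultimately show ?thesis by simp
qed

lemma frobenius_norm_le_trace:
  assumes "psd X"
  shows "frobenius_norm X \<le> Re (trace X)"
  unfolding frobenius_norm_eq_entries trace_eq_sqrt_entries[OF assms]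
  by (intro real_sqrt_le_mono sum_mono psd_entry_bound[OF assms])

lemma frobenius_norm_eq_trace_iff:
  assumes "psd X"
  shows "frobenius_norm X = Re (trace X) \<longleftrightarrow>
    (\<forall>i j. (cmod (X $ i $ j))\<^sup>2 = Re (X $ i $ i) * Re (X $ j $ j))"
proof -
  define gap where "gap i j = Re (X $ i $ i) * Re (X $ j $ j) - (cmod (X $ i $ j))\<^sup>2" for i j
  have gap: "gap i j \<ge> 0" for i j
    using psd_entry_bound[OF assms] by (simp add: gap_def)
  have "frobenius_norm X = Re (trace X) \<longleftrightarrow> (\<Sum>i\<in>UNIV. \<Sum>j\<in>UNIV. gap i j) = 0"
    unfolding frobenius_norm_eq_entries trace_eq_sqrt_entries[OF assms] gap_def
    by (auto simp: sum_subtractf)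
  also have "\<dots> \<longleftrightarrow> (\<forall>i j. gap i j = 0)"
    by (simp add: sum_nonneg_eq_0_iff sum_nonneg gap)
  finally show ?thesis
    by (auto simp: gap_def)
qed

theorem psd_frobenius_norm_eq_trace_iff_rank_1:
  assumes "psd X" "X \<noteq> 0"
  shows "frobenius_norm X = Re (trace X) \<longleftrightarrow> rank X = 1"
proof
  assume "frobenius_norm X = Re (trace X)"
  then have eq: "(cmod (X $ i $ j))\<^sup>2 = Re (X $ i $ i) * Re (X $ j $ j)" for i j
    using frobenius_norm_eq_trace_iff[OF assms(1)] by blast
  obtain k l where "X $ k $ l \<noteq> 0"
    using assms(2) by (auto simp: vec_eq_iff)
  with eq[of k l] have k: "X $ k $ k \<noteq> 0"
    by auto
  then have "X $ i $ j = X $ i $ k * (X $ k $ j / X $ k $ k)" for i j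
    using psd_entry_equality_columns[OF assms(1) eq, of k i j] by (simp add: field_simps)
  then have "\<exists>c r. \<forall>i j. X $ i $ j = c i * r j"
    by (intro exI[of _ "\<lambda>i. X $ i $ k"] exI[of _ "\<lambda>j. X $ k $ j / X $ k $ k"]) blast
  with assms(2) show "rank X = 1"
    unfolding rank_eq_1_iff by blast
next
  assume "rank X = 1"
  then obtain c r where cr: "\<And>i j. X $ i $ j = c i * r j"
    unfolding rank_eq_1_iff by blast
  have "(cmod (X $ i $ j))\<^sup>2 = Re (X $ i $ i) * Re (X $ j $ j)" for i j
  proof -
    have "complex_of_real ((cmod (X $ i $ j))\<^sup>2) = X $ i $ j * X $ j $ i"
      unfolding complex_norm_square by (simp add: hermitian_entry[OF psd_hermitian[OF assms(1)]])
    also have "\<dots> = X $ i $ i * X $ j $ j"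
      by (simp add: cr mult_ac)
    also have "\<dots> = of_real (Re (X $ i $ i) * Re (X $ j $ j))"
      using psd_diag(2)[OF assms(1)] by (metis of_real_mult)
    finally show ?thesis
      by (simp only: of_real_eq_iff)
  qed
  then show "frobenius_norm X = Re (trace X)"
    using frobenius_norm_eq_trace_iff[OF assms(1)] by blast
qed

section \<open>Equivalence of the two problems\<close>

lemma is_arg_min_zero_iff:
  fixes f :: "'a \<Rightarrow> real"
  assumes "\<And>y. P y \<Longrightarrow> 0 \<le> f y" "P x0" "f x0 = 0"
  shows "is_arg_min f P x \<longleftrightarrow> P x \<and> f x = 0"
  unfolding is_arg_min_linorder using assms by (metis order_antisym)

lemma real_linear_on_zero:
  assumes "real_linear_on S f" "0 \<in> S"
  shows "f 0 = 0"
  using assms unfolding real_linear_on_def by (metis scaleR_zero_left)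

theorem corollary3p1:
  fixes \<A> :: "complex^'n^'n \<Rightarrow> real^'m"
    and xhat :: "complex^'n"
    and Xhat :: "complex^'n^'n"
    and b :: "real^'m"
    and lam :: real
  assumes "real_linear_on hermitian \<A>"
    and "Xhat = outer_self xhat"
    and "b = \<A> Xhat"
    and "b \<noteq> 0"
    and "lam > 0"
  shows "{X. is_arg_min (\<lambda>X. (norm (\<A> X - b))\<^sup>2) (\<lambda>X. psd X \<and> rank X = 1) X} =
         {X. is_arg_min (\<lambda>X. 1/2 * (norm (\<A> X - b))\<^sup>2 + lam * (Re (trace X) - frobenius_norm X))
               psd X}"
proof -
  let ?f = "\<lambda>X. (norm (\<A> X - b))\<^sup>2"
  let ?g = "\<lambda>X. 1/2 * (norm (\<A> X - b))\<^sup>2 + lam * (Re (trace X) - frobenius_norm X)"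
  have A0: "\<A> 0 = 0"
    using real_linear_on_zero[OF assms(1) subspace_0[OF subspace_hermitian]] .
  have psd_hat: "psd Xhat"
    by (simp add: assms(2) psd_outer_self)
  have "Xhat \<noteq> 0"
    using A0 assms(3,4) by auto
  then have rank_hat: "rank Xhat = 1"
    unfolding rank_eq_1_iff by (auto simp: assms(2) outer_self_def)
  have pen_nonneg: "0 \<le> lam * (Re (trace X) - frobenius_norm X)" if "psd X" for X :: "complex^'n^'n"
    using frobenius_norm_le_trace[OF that] assms(5) by simp
  have g_zero: "?g X = 0 \<longleftrightarrow> rank X = 1 \<and> ?f X = 0" if "psd X" for X
  proof -
    have "?g X = 0 \<longleftrightarrow> ?f X = 0 \<and> lam * (Re (trace X) - frobenius_norm X) = 0"
      using add_nonneg_eq_0_iff[OF _ pen_nonneg[OF that], of "1/2 * ?f X"] by simp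
    also have "\<dots> \<longleftrightarrow> \<A> X = b \<and> frobenius_norm X = Re (trace X)"
      using assms(5) by auto
    also have "\<dots> \<longleftrightarrow> \<A> X = b \<and> rank X = 1"
    proof (cases "X = 0")
      case True
      then show ?thesis using A0 assms(4) by auto
    next
      case False
      then show ?thesis
        using psd_frobenius_norm_eq_trace_iff_rank_1[OF that] by blast
    qed
    finally show ?thesis by auto
  qed
  have "is_arg_min ?f (\<lambda>X. psd X \<and> rank X = 1) X \<longleftrightarrow> (psd X \<and> rank X = 1) \<and> ?f X = 0" for X
    by (rule is_arg_min_zero_iff[where ?x0.0 = Xhat])
      (use psd_hat rank_hat assms(3) in auto)
  moreover have "is_arg_min ?g psd X \<longleftrightarrow> psd X \<and> ?g X = 0" for X
  proof (rule is_arg_min_zero_iff[where ?x0.0 = Xhat])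
    show "0 \<le> ?g Y" if "psd Y" for Y
      using pen_nonneg[OF that] by simp
    show "?g Xhat = 0"
      using g_zero[OF psd_hat] rank_hat assms(3) by simp
  qed (rule psd_hat)
  ultimately show ?thesis
    using g_zero by blast
qed

end
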